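(* If $G$ is a digraph with $\delta^-(G)\ge 1$ such that $\rho^{\rm o}(G)=\gamma_t(G)$, then $\gamma_t(G\times H)=\gamma_t(G)\gamma_t(H)$ for every digraph $H$ with $\delta^-(H)\ge 1$.
   Context: All digraphs are finite, and their arc relation is irreflexive (no loops). For a digraph $D$ and vertex $v$, $N^+_D(v)$ is the set of out-neighbors and $N^-_D(v)$ the set of in-neighbors of $v$; $\delta^-(D)$ is the minimum in-degree. If $\delta^-(D)\ge1$, a set $S$ is a total dominating set if $\bigcup_{v\in S}N^+_D(v)=V(D)$, and $\gamma_t(D)$ is the minimum size of a total dominating set. A set $B\subseteq V(D)$ is an open packing if $N^-_D(u)\cap N^-_D(v)=\emptyset$ for all distinct $u,v\in B$; $\rho^{\rm o}(D)$ is the maximum size of an open packing. The direct product $G\times H$ has vertex set $V(G)\times V(H)$, with an arc from $(g_1,h_1)$ to $(g_2,h_2)$ iff $g_1g_2\in A(G)$ and $h_1h_2\in A(H)$. *)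

theory Defs
  imports "Graph_Theory.Digraph"
begin

definition out_neighbors :: "('a, 'b) pre_digraph \<Rightarrow> 'a \<Rightarrow> 'a set" where
  "out_neighbors D v = {u. v \<rightarrow>\<^bsub>D\<^esub> u}"

definition in_neighbors :: "('a, 'b) pre_digraph \<Rightarrow> 'a \<Rightarrow> 'a set" where
  "in_neighbors D v = {u. u \<rightarrow>\<^bsub>D\<^esub> v}"

text \<open>Unspecified for the null digraph, which the library admits.\<close>

definition min_in_degree :: "('a, 'b) pre_digraph \<Rightarrow> nat" where
  "min_in_degree D = Min (in_degree D ` verts D)"

definition total_dominating :: "('a, 'b) pre_digraph \<Rightarrow> 'a set \<Rightarrow> bool" where
  "total_dominating D S \<longleftrightarrow> S \<subseteq> verts D \<and> (\<Union>v\<in>S. out_neighbors D v) = verts D"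

text \<open>Meaningful when the minimum in-degree is positive: otherwise no total dominating set
  exists and the value is unspecified.\<close>

definition total_domination_number :: "('a, 'b) pre_digraph \<Rightarrow> nat" where
  "total_domination_number D = Min {card S |S. total_dominating D S}"

definition open_packing :: "('a, 'b) pre_digraph \<Rightarrow> 'a set \<Rightarrow> bool" where
  "open_packing D B \<longleftrightarrow> B \<subseteq> verts D \<and>
     (\<forall>u\<in>B. \<forall>v\<in>B. u \<noteq> v \<longrightarrow> in_neighbors D u \<inter> in_neighbors D v = {})"

definition open_packing_number :: "('a, 'b) pre_digraph \<Rightarrow> nat" where
  "open_packing_number D = Max {card B |B. open_packing D B}"

definition direct_product ::
  "('a, 'b) pre_digraph \<Rightarrow> ('c, 'd) pre_digraph \<Rightarrow> ('a \<times> 'c, 'b \<times> 'd) pre_digraph" where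
  "direct_product G H =
     \<lparr> verts = verts G \<times> verts H, arcs = arcs G \<times> arcs H,
       tail = map_prod (tail G) (tail H), head = map_prod (head G) (head H) \<rparr>"

lemma direct_product_dominates_iff:
  "(g1, h1) \<rightarrow>\<^bsub>direct_product G H\<^esub> (g2, h2) \<longleftrightarrow> g1 \<rightarrow>\<^bsub>G\<^esub> g2 \<and> h1 \<rightarrow>\<^bsub>H\<^esub> h2"
  by (force simp: direct_product_def arcs_ends_conv)

lemma digraph_direct_product:
  assumes "digraph G" "digraph H"
  shows "digraph (direct_product G H)"
proof -
  interpret G: digraph G by fact
  interpret H: digraph H by fact
  show ?thesis
    by unfold_locales
      (auto simp: direct_product_def arc_to_ends_def
        intro: G.no_multi_arcs H.no_multi_arcs dest: G.no_loops)
qed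

lemma min_in_degree_ge_1_iff:
  assumes "digraph D" "verts D \<noteq> {}"
  shows "min_in_degree D \<ge> 1 \<longleftrightarrow> (\<forall>v\<in>verts D. in_neighbors D v \<noteq> {})"
proof -
  interpret digraph D by fact
  have "in_degree D v \<ge> 1 \<longleftrightarrow> in_neighbors D v \<noteq> {}" for v
  proof -
    have "finite (in_arcs D v)" by (simp add: in_arcs_def)
    then have "in_degree D v \<ge> 1 \<longleftrightarrow> in_arcs D v \<noteq> {}"
      by (simp add: in_degree_def Suc_le_eq card_gt_0_iff)
    also have "\<dots> \<longleftrightarrow> in_neighbors D v \<noteq> {}"
      by (auto simp: in_arcs_def in_neighbors_def arcs_ends_conv)
    finally show ?thesis .
  qed
  with assms(2) show ?thesis
    by (simp add: min_in_degree_def)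
qed

lemma total_dominating_verts:
  assumes "digraph D" "min_in_degree D \<ge> 1"
  shows "total_dominating D (verts D)"
proof (cases "verts D = {}")
  case True
  then show ?thesis by (simp add: total_dominating_def)
next
  case False
  interpret digraph D by fact
  have "\<exists>u\<in>verts D. u \<rightarrow>\<^bsub>D\<^esub> v" if "v \<in> verts D" for v
    using that assms min_in_degree_ge_1_iff[OF assms(1) False] adj_in_verts
    by (fastforce simp: in_neighbors_def)
  then show ?thesis
    using adj_in_verts by (auto simp: total_dominating_def out_neighbors_def)
qed

end

(* The product of two total dominating sets is total dominating, which gives the upper bound.
   For the lower bound, take a maximum open packing B of G and a total dominating set S of
   G x H. The parts of S lying over the in-neighborhoods of the vertices of B are pairwise
   disjoint, and each of them projects onto a total dominating set of H, because S dominates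
   the whole fiber over every b in B. So S has at least |B| times the total domination number
   of H many elements. *)

theory Submission
  imports Defs
begin

text \<open>Arcs of a digraph end in its vertex set, so of the equality in the definition only the
  covering half has to be checked.\<close>

lemma total_dominating_iff:
  assumes "digraph D"
  shows "total_dominating D S \<longleftrightarrow>
    S \<subseteq> verts D \<and> (\<forall>v\<in>verts D. \<exists>u\<in>S. u \<rightarrow>\<^bsub>D\<^esub> v)"
proof -
  interpret digraph D by fact
  show ?thesis
    using adj_in_verts unfolding total_dominating_def out_neighbors_def by blast
qed

text \<open>\<open>Min\<close> and \<open>Max\<close> say something only about finite sets; this
  supplies the finiteness for both the domination and the packing number.\<close>

lemma finite_card_subsets:
  assumes "finite A" "\<And>S. P S \<Longrightarrow> S \<subseteq> A"
  shows "finite {card S |S. P S}"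
proof -
  have "{card S |S. P S} \<subseteq> card ` Pow A"
    using assms(2) by blast
  then show ?thesis
    using assms(1) by (meson finite_Pow_iff finite_imageI finite_subset)
qed

lemma finite_card_total_dominating:
  assumes "finite (verts D)"
  shows "finite {card S |S. total_dominating D S}"
  using assms by (rule finite_card_subsets) (simp add: total_dominating_def)

lemma total_domination_number_le:
  assumes "finite (verts D)" "total_dominating D S"
  shows "total_domination_number D \<le> card S"
  unfolding total_domination_number_def
  using assms by (auto intro!: Min_le finite_card_total_dominating)

text \<open>The set \<open>T\<close> serves only as a witness that the \<open>Min\<close> is taken
  over a nonempty set, and hence attained.\<close>

lemma minimum_total_dominating_set:
  assumes "finite (verts D)" "total_dominating D T"
  obtains S where "total_dominating D S" "card S = total_domination_number D"
proof -
  have "total_domination_number D \<in> {card S |S. total_dominating D S}"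
    unfolding total_domination_number_def
    using assms by (intro Min_in finite_card_total_dominating) auto
  then show ?thesis
    using that by auto
qed

lemma maximum_open_packing:
  assumes "finite (verts D)"
  obtains B where "open_packing D B" "card B = open_packing_number D"
proof -
  have "finite {card B |B. open_packing D B}"
    using assms by (rule finite_card_subsets) (simp add: open_packing_def)
  \<comment> \<open>The empty packing makes the set under \<open>Max\<close> nonempty.\<close>
  moreover have "open_packing D {}"
    by (simp add: open_packing_def)
  ultimately have "open_packing_number D \<in> {card B |B. open_packing D B}"
    unfolding open_packing_number_def by (intro Max_in) auto
  then show ?thesis
    using that by auto
qed

lemma total_dominating_direct_product:
  assumes "digraph G" "digraph H" "total_dominating G S" "total_dominating H T"
  shows "total_dominating (direct_product G H) (S \<times> T)"
  unfolding total_dominating_iff[OF digraph_direct_product[OF assms(1,2)]]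
proof (intro conjI ballI)
  show "S \<times> T \<subseteq> verts (direct_product G H)"
    using assms(3,4) by (auto simp: direct_product_def total_dominating_def)
next
  fix v assume "v \<in> verts (direct_product G H)"
  then obtain g h where v: "v = (g, h)" "g \<in> verts G" "h \<in> verts H"
    by (auto simp: direct_product_def)
  obtain s where "s \<in> S" "s \<rightarrow>\<^bsub>G\<^esub> g"
    using assms(3) v(2) unfolding total_dominating_iff[OF assms(1)] by blast
  moreover obtain t where "t \<in> T" "t \<rightarrow>\<^bsub>H\<^esub> h"
    using assms(4) v(3) unfolding total_dominating_iff[OF assms(2)] by blast
  ultimately show "\<exists>u\<in>S \<times> T. u \<rightarrow>\<^bsub>direct_product G H\<^esub> v"
    unfolding v(1) by (intro bexI[of _ "(s, t)"]) (simp_all add: direct_product_dominates_iff)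
qed

text \<open>Any in-neighbor of \<open>(b, h)\<close> in the product lies over an in-neighbor of
  \<open>b\<close>, and its second coordinate is an in-neighbor of \<open>h\<close>. Letting
  \<open>h\<close> run through \<open>verts H\<close> with \<open>b\<close> fixed gives the
  claim.\<close>

lemma total_dominating_projection:
  assumes "digraph G" "digraph H" "total_dominating (direct_product G H) S" "b \<in> verts G"
  shows "total_dominating H (snd ` (S \<inter> in_neighbors G b \<times> UNIV))"
  unfolding total_dominating_iff[OF assms(2)]
proof (intro conjI ballI)
  show "snd ` (S \<inter> in_neighbors G b \<times> UNIV) \<subseteq> verts H"
    using assms(3) by (auto simp: direct_product_def total_dominating_def)
next
  fix h assume "h \<in> verts H"
  then have "(b, h) \<in> verts (direct_product G H)"
    using assms(4) by (simp add: direct_product_def)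
  then obtain g' h' where "(g', h') \<in> S" "(g', h') \<rightarrow>\<^bsub>direct_product G H\<^esub> (b, h)"
    using assms(3) unfolding total_dominating_iff[OF digraph_direct_product[OF assms(1,2)]]
    by (metis surj_pair)
  then show "\<exists>u\<in>snd ` (S \<inter> in_neighbors G b \<times> UNIV). u \<rightarrow>\<^bsub>H\<^esub> h"
    by (intro bexI[of _ h'] image_eqI[of _ _ "(g', h')"])
      (simp_all add: direct_product_dominates_iff in_neighbors_def)
qed

lemma open_packing_mult_total_domination_number_le:
  assumes "digraph G" "digraph H" "open_packing G B" "total_dominating (direct_product G H) S"
  shows "card B * total_domination_number H \<le> card S"
proof -
  interpret G: digraph G by fact
  interpret H: digraph H by fact
  define F where "F b = S \<inter> in_neighbors G b \<times> UNIV" for b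
  have B: "B \<subseteq> verts G"
    using assms(3) by (simp add: open_packing_def)
  then have finB: "finite B"
    using G.finite_verts by (rule finite_subset)
  have "S \<subseteq> verts G \<times> verts H"
    using assms(4) by (simp add: total_dominating_def direct_product_def)
  then have finS: "finite S"
    by (rule finite_subset) simp
  then have finF: "finite (F b)" for b
    by (simp add: F_def)
  have "total_domination_number H \<le> card (F b)" if "b \<in> B" for b
  proof -
    have "total_dominating H (snd ` F b)"
      unfolding F_def using assms(1,2,4) B that by (blast intro: total_dominating_projection)
    then have "total_domination_number H \<le> card (snd ` F b)"
      by (simp add: total_domination_number_le)
    \<comment> \<open>Several elements of \<open>F b\<close> may share a second coordinate, so the
      projection can only lose elements.\<close>
    also have "\<dots> \<le> card (F b)"
      using finF by (rule card_image_le)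
    finally show ?thesis .
  qed
  then have "card B * total_domination_number H \<le> (\<Sum>b\<in>B. card (F b))"
    using sum_bounded_below[of B "total_domination_number H" "\<lambda>b. card (F b)"] by simp
  also have "\<dots> = card (\<Union>b\<in>B. F b)"
  proof -
    \<comment> \<open>The first coordinate of a common element would be a common in-neighbor of
      \<open>b\<close> and \<open>c\<close>.\<close>
    have "F b \<inter> F c = {}" if "b \<in> B" "c \<in> B" "b \<noteq> c" for b c
      using assms(3) that unfolding open_packing_def F_def by blast
    then show ?thesis
      using finB finF by (simp add: card_UN_disjoint)
  qed
  also have "\<dots> \<le> card S"
    using finS by (intro card_mono) (auto simp: F_def)
  finally show ?thesis .
qed

theorem theorem1p4:
  fixes G :: "('a, 'b) pre_digraph" and H :: "('c, 'd) pre_digraph"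
  assumes "digraph G" and "min_in_degree G \<ge> 1"
    and "open_packing_number G = total_domination_number G"
    and "digraph H" and "min_in_degree H \<ge> 1"
  shows "total_domination_number (direct_product G H)
    = total_domination_number G * total_domination_number H"
proof (rule antisym)
  interpret G: digraph G by fact
  interpret H: digraph H by fact
  interpret P: digraph "direct_product G H"
    using assms(1,4) by (rule digraph_direct_product)
  obtain S where S: "total_dominating G S" "card S = total_domination_number G"
    using minimum_total_dominating_set[OF G.finite_verts total_dominating_verts] assms(1,2) .
  obtain T where T: "total_dominating H T" "card T = total_domination_number H"
    using minimum_total_dominating_set[OF H.finite_verts total_dominating_verts] assms(4,5) .
  \<comment> \<open>This set is used twice: its size gives the upper bound, and its existence
    guarantees the minimum set \<open>U\<close> below.\<close>
  have ST: "total_dominating (direct_product G H) (S \<times> T)"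
    using assms(1,4) S(1) T(1) by (rule total_dominating_direct_product)
  show "total_domination_number (direct_product G H)
      \<le> total_domination_number G * total_domination_number H"
    using total_domination_number_le[OF P.finite_verts ST] S(2) T(2)
    by (simp add: card_cartesian_product)
  obtain U where U: "total_dominating (direct_product G H) U"
    "card U = total_domination_number (direct_product G H)"
    using minimum_total_dominating_set[OF P.finite_verts ST] .
  obtain B where B: "open_packing G B" "card B = open_packing_number G"
    using maximum_open_packing[OF G.finite_verts] .
  \<comment> \<open>Here the equality of packing and domination number enters: it turns
    \<open>card B\<close> into \<open>total_domination_number G\<close>.\<close>
  show "total_domination_number G * total_domination_number H
      \<le> total_domination_number (direct_product G H)"
    using open_packing_mult_total_domination_number_le[OF assms(1,4) B(1) U(1)]
    by (simp add: B(2) U(2) assms(3))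
qed

end
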